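(* Assume that $q\ge p>1$ and $\sigma\ge 2(q-p)(p-1)^{-1}$. When $n\ge 3$, assume further that $1<q<\frac{n+2}{n-2}$. If $\mu$ and $u_0(x)$ are large enough, then the solutions $u(x,t)$ for the Cauchy, (homogeneous) Neumann, and (homogeneous) Dirichlet problems of $$\begin{cases} v_t=d_1\Delta v+f(x,v) & \text{in }D\times(0,\infty),\\ u_t=d_2\Delta u+\mu u^p-|m-v|^\sigma u^q & \text{in }D\times(0,\infty),\\ v(x,0)=v_0(x)\ge0,\quad u(x,0)=u_0(x)\ge 0, & x\in D,\end{cases}$$ blow up in finite time.
   Context: $D=\mathbb{R}^n$ (Cauchy problem) or $D\subset\mathbb{R}^n$ is a smooth bounded domain (homogeneous Neumann or Dirichlet problem, i.e. zero normal derivatives, respectively zero values, on $\partial D$). $d_1,d_2,\mu$ are nonnegative constants and $f$ is a smooth function. The function $v(x,t)=v_0(x)$, independent of $t$, is an entire solution on $\mathbb{R}^n$, or a solution of the corresponding homogeneous elliptic Neumann or Dirichlet problem, of the $v$-equation, and $m=v_0(x_0)$ for some $x_0\in D$. Substituting $v=v_0$ gives a scalar equation for $u$ of the form $u_t=d_2\Delta u+\mu u^p-a(x)u^q$ with $a(x)=|m-v_0(x)|^\sigma$. Blowup in finite time means that the maximal existence time $T^*$ of the solution $u$ is finite, in which case $\lim_{t\to T^*}\|u(\cdot,t)\|_\infty=\infty$. For the Cauchy problem the solution $u$ is always assumed to satisfy $|u(x,t)|\le M|x|^{\frac{2}{p-1}}$ for $(x,t)\in\mathbb{R}^n\times(0,T^*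 )$, for some constant $M>0$. *)

theory Defs
  imports "HOL-Analysis.Analysis"
begin

subsection \<open>Smoothness and differential operators\<close>

(* Only meant for open S: all derivatives are two-sided. *)
primrec Ck_on :: "nat \<Rightarrow> 'a::euclidean_space set \<Rightarrow> ('a \<Rightarrow> real) \<Rightarrow> bool" where
  "Ck_on 0 S g \<longleftrightarrow> continuous_on S g"
| "Ck_on (Suc k) S g \<longleftrightarrow>
     (\<forall>x\<in>S. g differentiable (at x)) \<and>
     (\<forall>b\<in>Basis. Ck_on k S (\<lambda>x. frechet_derivative g (at x) b))"

definition smooth_on :: "'a::euclidean_space set \<Rightarrow> ('a \<Rightarrow> real) \<Rightarrow> bool" where
  "smooth_on S g \<longleftrightarrow> (\<forall>k. Ck_on k S g)"

definition partial_deriv :: "'n \<Rightarrow> (real^'n::finite \<Rightarrow> real) \<Rightarrow> real^'n \<Rightarrow> real" where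
  "partial_deriv i g x = frechet_derivative g (at x) (axis i 1)"

definition laplacian :: "(real^'n::finite \<Rightarrow> real) \<Rightarrow> real^'n \<Rightarrow> real" where
  "laplacian g x = (\<Sum>i\<in>UNIV. partial_deriv i (partial_deriv i g) x)"

subsection \<open>Domains and boundary conditions\<close>

definition local_defining_function ::
    "(real^'n::finite) set \<Rightarrow> real^'n \<Rightarrow> (real^'n) set \<Rightarrow> (real^'n \<Rightarrow> real) \<Rightarrow> bool" where
  "local_defining_function D z U \<rho> \<longleftrightarrow>
     open U \<and> z \<in> U \<and> smooth_on U \<rho> \<and>
     (\<forall>x\<in>U. frechet_derivative \<rho> (at x) \<noteq> (\<lambda>h. 0)) \<and>
     D \<inter> U = {x\<in>U. \<rho> x < 0} \<and> frontier D \<inter> U = {x\<in>U. \<rho> x = 0}"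

definition smooth_bounded_domain :: "(real^'n::finite) set \<Rightarrow> bool" where
  "smooth_bounded_domain D \<longleftrightarrow>
     open D \<and> connected D \<and> D \<noteq> {} \<and> bounded D \<and>
     (\<forall>z\<in>frontier D. \<exists>U \<rho>. local_defining_function D z U \<rho>)"

definition outward_unit_normal :: "(real^'n::finite) set \<Rightarrow> real^'n \<Rightarrow> real^'n \<Rightarrow> bool" where
  "outward_unit_normal D z \<nu> \<longleftrightarrow>
     norm \<nu> = 1 \<and>
     (\<exists>U \<rho> c. local_defining_function D z U \<rho> \<and> c > 0 \<and>
        (\<rho> has_derivative (\<lambda>h. c * (\<nu> \<bullet> h))) (at z))"

datatype problem_kind = Cauchy | Neumann | Dirichlet

fun admissible_domain :: "problem_kind \<Rightarrow> (real^'n::finite) set \<Rightarrow> bool" where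
  "admissible_domain Cauchy D \<longleftrightarrow> D = UNIV"
| "admissible_domain Neumann D \<longleftrightarrow> smooth_bounded_domain D"
| "admissible_domain Dirichlet D \<longleftrightarrow> smooth_bounded_domain D"

(* The normal derivative is one-sided, from inside D: functions are total in HOL,
   but their values outside the closure of D carry no meaning. *)
fun boundary_condition ::
    "problem_kind \<Rightarrow> (real^'n::finite) set \<Rightarrow> (real^'n \<Rightarrow> real) \<Rightarrow> bool" where
  "boundary_condition Cauchy D w \<longleftrightarrow> True"
| "boundary_condition Neumann D w \<longleftrightarrow>
     (\<forall>z\<in>frontier D. \<forall>\<nu>. outward_unit_normal D z \<nu> \<longrightarrow>
        ((\<lambda>h. (w z - w (z - h *\<^sub>R \<nu>)) / h) \<longlongrightarrow> 0) (at_right 0))"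
| "boundary_condition Dirichlet D w \<longleftrightarrow> (\<forall>z\<in>frontier D. w z = 0)"

subsection \<open>Stationary and time-dependent solutions\<close>

definition stationary_solution ::
    "problem_kind \<Rightarrow> (real^'n::finite) set \<Rightarrow> real \<Rightarrow> (real^'n \<Rightarrow> real \<Rightarrow> real) \<Rightarrow>
     (real^'n \<Rightarrow> real) \<Rightarrow> bool" where
  "stationary_solution P D d f w \<longleftrightarrow>
     Ck_on 2 D w \<and> continuous_on (closure D) w \<and>
     (\<forall>x\<in>D. d * laplacian w x + f x (w x) = 0) \<and>
     boundary_condition P D w"

(* Existence times are extended reals, so that T = \<infinity> is allowed. *)
definition open_times :: "ereal \<Rightarrow> real set" where
  "open_times T = {t. 0 < t \<and> ereal t < T}"

definition times :: "ereal \<Rightarrow> real set" where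
  "times T = {t. 0 \<le> t \<and> ereal t < T}"

definition C21_on :: "(real^'n::finite) set \<Rightarrow> real set \<Rightarrow> (real^'n \<Rightarrow> real \<Rightarrow> real) \<Rightarrow> bool" where
  "C21_on D I w \<longleftrightarrow>
     (\<forall>t\<in>I. Ck_on 2 D (\<lambda>x. w x t)) \<and>
     (\<forall>x\<in>D. \<forall>t\<in>I. w x differentiable (at t)) \<and>
     continuous_on (D \<times> I) (\<lambda>(x, t). w x t) \<and>
     continuous_on (D \<times> I) (\<lambda>(x, t). deriv (w x) t) \<and>
     (\<forall>i. continuous_on (D \<times> I) (\<lambda>(x, t). partial_deriv i (\<lambda>y. w y t) x)) \<and>
     (\<forall>i j. continuous_on (D \<times> I)
        (\<lambda>(x, t). partial_deriv i (partial_deriv j (\<lambda>y. w y t)) x))"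

(* Classical solution of w_t = d \<Delta>w + F(x,t,w) in D x (0,T) with w(x,0) = w0(x).
   Continuity is not required on the corner (boundary of D) x {0}, so initial data
   that do not match the boundary condition are allowed. *)
definition parabolic_solution ::
    "problem_kind \<Rightarrow> (real^'n::finite) set \<Rightarrow> real \<Rightarrow> (real^'n \<Rightarrow> real \<Rightarrow> real \<Rightarrow> real) \<Rightarrow>
     (real^'n \<Rightarrow> real) \<Rightarrow> (real^'n \<Rightarrow> real \<Rightarrow> real) \<Rightarrow> ereal \<Rightarrow> bool" where
  "parabolic_solution P D d F w0 w T \<longleftrightarrow>
     C21_on D (open_times T) w \<and>
     continuous_on (D \<times> times T \<union> closure D \<times> open_times T) (\<lambda>(x, t). w x t) \<and>
     (\<forall>x\<in>D. \<forall>t\<in>open_times T.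
        deriv (w x) t = d * laplacian (\<lambda>y. w y t) x + F x t (w x t)) \<and>
     (\<forall>x\<in>D. w x 0 = w0 x) \<and>
     (\<forall>t\<in>open_times T. boundary_condition P D (\<lambda>x. w x t))"

(* Power of a nonnegative base with the convention r^0 = 1, including r = 0
   (whereas 0 powr 0 = 0); this matters for \<sigma> = 0, which is allowed if p = q. *)
definition npow :: "real \<Rightarrow> real \<Rightarrow> real" where
  "npow r s = (if s = 0 then 1 else r powr s)"

(* For the Cauchy problem, |u(x,t)| \<le> M |x|^(2/(p-1)) is a growth bound at infinity, with M
   uniform in time.  Imposing it near x = 0 as well would force u(0,t) = 0 for all t. *)
fun growth_condition ::
    "problem_kind \<Rightarrow> real \<Rightarrow> (real^'n::finite \<Rightarrow> real \<Rightarrow> real) \<Rightarrow> ereal \<Rightarrow> bool" where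
  "growth_condition Cauchy p u T \<longleftrightarrow>
     (\<exists>M>0. \<exists>R. \<forall>x. \<forall>t\<in>open_times T. norm x \<ge> R \<longrightarrow> \<bar>u x t\<bar> \<le> M * norm x powr (2 / (p - 1)))"
| "growth_condition Neumann p u T \<longleftrightarrow> True"
| "growth_condition Dirichlet p u T \<longleftrightarrow> True"

definition system_solution ::
    "problem_kind \<Rightarrow> (real^'n::finite) set \<Rightarrow> real \<Rightarrow> real \<Rightarrow> (real^'n \<Rightarrow> real \<Rightarrow> real) \<Rightarrow>
     real \<Rightarrow> real \<Rightarrow> real \<Rightarrow> real \<Rightarrow> real \<Rightarrow> (real^'n \<Rightarrow> real) \<Rightarrow> (real^'n \<Rightarrow> real) \<Rightarrow>
     (real^'n \<Rightarrow> real \<Rightarrow> real) \<Rightarrow> (real^'n \<Rightarrow> real \<Rightarrow> real) \<Rightarrow> ereal \<Rightarrow> bool" where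
  "system_solution P D d1 d2 f \<mu> m \<sigma> p q v0 u0 v u T \<longleftrightarrow>
     parabolic_solution P D d1 (\<lambda>x t s. f x s) v0 v T \<and>
     parabolic_solution P D d2
       (\<lambda>x t s. \<mu> * npow s p - npow \<bar>m - v x t\<bar> \<sigma> * npow s q) u0 u T \<and>
     (\<forall>x\<in>D. \<forall>t\<in>times T. u x t \<ge> 0) \<and>
     growth_condition P p u T"

(* T is the maximal existence time of u, with the first component v given.  Finite-time
   blowup of u means T < \<infinity>; T = \<infinity> says that u is a global solution. *)
definition maximal_solution ::
    "problem_kind \<Rightarrow> (real^'n::finite) set \<Rightarrow> real \<Rightarrow> real \<Rightarrow> (real^'n \<Rightarrow> real \<Rightarrow> real) \<Rightarrow>
     real \<Rightarrow> real \<Rightarrow> real \<Rightarrow> real \<Rightarrow> real \<Rightarrow> (real^'n \<Rightarrow> real) \<Rightarrow> (real^'n \<Rightarrow> real) \<Rightarrow>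
     (real^'n \<Rightarrow> real \<Rightarrow> real) \<Rightarrow> (real^'n \<Rightarrow> real \<Rightarrow> real) \<Rightarrow> ereal \<Rightarrow> bool" where
  "maximal_solution P D d1 d2 f \<mu> m \<sigma> p q v0 u0 v u T \<longleftrightarrow>
     0 < T \<and> system_solution P D d1 d2 f \<mu> m \<sigma> p q v0 u0 v u T \<and>
     \<not> (\<exists>T' w. T < T' \<and> system_solution P D d1 d2 f \<mu> m \<sigma> p q v0 u0 v w T' \<and>
          (\<forall>x\<in>D. \<forall>t\<in>times T. w x t = u x t))"

(* Lower barriers for "u0 large enough".  The compact support in D makes u0 \<ge> \<phi>
   compatible with every boundary condition. *)
definition initial_threshold :: "(real^'n::finite) set \<Rightarrow> (real^'n \<Rightarrow> real) \<Rightarrow> bool" where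
  "initial_threshold D \<phi> \<longleftrightarrow>
     continuous_on UNIV \<phi> \<and> (\<forall>x. 0 \<le> \<phi> x) \<and>
     (\<exists>K. compact K \<and> K \<subseteq> D \<and> (\<forall>x. x \<notin> K \<longrightarrow> \<phi> x = 0))"

end

(* With b = 1/(p-1), the function (T - t)^(-b) * (1 - |x-x0|^2 / (T - t))_+^2 is self-similar for
   w_t = d \<Delta>w + \<mu> w^p and blows up at (x0, T).  On its support a(x) = |m - v0(x)|^\<sigma> is at most a constant
   times (T - t)^(\<sigma>/2), because v0 is differentiable at x0, and \<sigma>/2 \<ge> b (q-p) says that the absorption
   a w^q then scales no worse than w^p; hence the function is a subsolution for large \<mu>.
   Since u \<ge> 0 and the support shrinks inside D, the maximum principle is only
   applied on the region |x-x0|^2 \<le> T - t, on whose lateral boundary the barrier vanishes. *)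
theory Submission
  imports Defs
begin

section \<open>Second-order conditions at a touching point\<close>

text \<open>If \<open>c\<close> were negative, \<open>g'\<close>, which vanishes at the minimum,
  would be negative just to the right of \<open>x\<close>, so \<open>g\<close> would drop below its
  minimal value there.\<close>

lemma second_deriv_nonneg_at_local_min:
  fixes g g' :: "real \<Rightarrow> real"
  assumes g: "\<forall>\<^sub>F h in nhds x. (g has_real_derivative g' h) (at h)"
    and g': "(g' has_real_derivative c) (at x)"
    and min: "\<forall>\<^sub>F h in nhds x. g x \<le> g h"
  shows "c \<ge> 0"
proof (rule ccontr)
  assume "\<not> c \<ge> 0"
  then have "c < 0" by simp
  from g min have "\<forall>\<^sub>F h in nhds x. (g has_real_derivative g' h) (at h) \<and> g x \<le> g h"
    by (rule eventually_conj)
  then obtain e where e: "e > 0"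
    and eD: "\<And>h. dist h x < e \<Longrightarrow> (g has_real_derivative g' h) (at h) \<and> g x \<le> g h"
    unfolding eventually_nhds_metric by blast
  have "g' x = 0"
    by (rule DERIV_local_min[of g "g' x" x e]) (use e eD in \<open>auto simp: dist_real_def\<close>)
  moreover obtain k where k: "k > 0" and kD: "\<And>h. h > 0 \<Longrightarrow> h < k \<Longrightarrow> g' x > g' (x + h)"
    using DERIV_neg_dec_right[OF g' \<open>c < 0\<close>] by blast
  ultimately have neg: "g' y < 0" if "x < y" "y < x + k" for y
    using kD[of "y - x"] that by simp
  define h where "h = min e k / 2"
  have h: "h > 0" "h < e" "h < k" using e k unfolding h_def by auto
  have "g (x + h) < g x"
  proof (rule DERIV_neg_imp_decreasing_open[of x "x + h" g])
    show "x < x + h" using h by simp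
    show "\<exists>y. (g has_real_derivative y) (at z) \<and> y < 0" if "x < z" "z < x + h" for z
      using that h eD[of z] neg[of z] by (auto simp: dist_real_def)
    show "continuous_on {x..x + h} g"
    proof (rule continuous_at_imp_continuous_on, rule ballI)
      fix z assume "z \<in> {x..x + h}"
      then show "isCont g z" using h eD[of z] by (auto simp: dist_real_def intro: DERIV_isCont)
    qed
  qed
  with eD[of "x + h"] h show False by (auto simp: dist_real_def)
qed

lemma frechet_derivative_along_line:
  fixes w :: "'a::real_normed_vector \<Rightarrow> real"
  assumes "w differentiable (at (x + h *\<^sub>R e))"
  shows "((\<lambda>k. w (x + k *\<^sub>R e)) has_real_derivative
           frechet_derivative w (at (x + h *\<^sub>R e)) e) (at h)"
proof -
  let ?L = "frechet_derivative w (at (x + h *\<^sub>R e))"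
  have w: "(w has_derivative ?L) (at (x + h *\<^sub>R e))"
    using assms by (simp add: frechet_derivative_works[symmetric])
  have "((\<lambda>k. x + k *\<^sub>R e) has_derivative (\<lambda>k. k *\<^sub>R e)) (at h)"
    by (auto intro!: derivative_eq_intros)
  from has_derivative_compose[OF this w]
  have "((\<lambda>k. w (x + k *\<^sub>R e)) has_derivative (\<lambda>k. ?L (k *\<^sub>R e))) (at h)" .
  moreover have "?L (k *\<^sub>R e) = ?L e * k" for k
    using linear_scale[OF has_derivative_linear[OF w], of k e] by simp
  ultimately show ?thesis by (simp add: has_field_derivative_def)
qed

lemma tendsto_along_line:
  fixes x e :: "'a::real_normed_vector"
  shows "((\<lambda>h. x + h *\<^sub>R e) \<longlongrightarrow> x) (nhds 0)"
  by (auto intro!: tendsto_eq_intros filterlim_ident)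

text \<open>This is the one-variable test applied to \<open>w - G\<close> along the i-th coordinate
  direction. A comparison function enters only through its restriction \<open>G\<close> to that
  line, so its multivariate derivatives never have to be computed.\<close>

lemma second_partial_ge_at_touching_point:
  fixes w :: "real^'n::finite \<Rightarrow> real"
  assumes D: "open D" "x \<in> D" and w: "Ck_on 2 D w"
    and G: "\<And>h. (G has_real_derivative G' h) (at h)"
    and G': "(G' has_real_derivative c) (at 0)"
    and min: "\<forall>\<^sub>F h in nhds 0. w x - G 0 \<le> w (x + h *\<^sub>R axis i 1) - G h"
  shows "c \<le> partial_deriv i (partial_deriv i w) x"
proof -
  let ?e = "axis i 1 :: real^'n"
  have e: "?e \<in> Basis" by (simp add: axis_in_Basis_iff)
  have d1: "w differentiable (at y)" if "y \<in> D" for y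
    using w that by (auto simp: numeral_2_eq_2)
  have d2: "partial_deriv i w differentiable (at y)" if "y \<in> D" for y
    using w that e unfolding partial_deriv_def[abs_def] by (auto simp: numeral_2_eq_2)
  from topological_tendstoD[OF tendsto_along_line D] have inD: "\<forall>\<^sub>F h in nhds 0. x + h *\<^sub>R ?e \<in> D" .
  let ?g = "\<lambda>h. w (x + h *\<^sub>R ?e) - G h"
  let ?g' = "\<lambda>h. partial_deriv i w (x + h *\<^sub>R ?e) - G' h"
  have "\<forall>\<^sub>F h in nhds 0. (?g has_real_derivative ?g' h) (at h)"
    using inD
  proof eventually_elim
    case (elim h)
    show ?case unfolding partial_deriv_def
      by (intro DERIV_diff frechet_derivative_along_line d1 elim G)
  qed
  moreover have "(?g' has_real_derivative partial_deriv i (partial_deriv i w) x - c) (at 0)"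
  proof (rule DERIV_diff[OF _ G'])
    have "partial_deriv i w differentiable at (x + 0 *\<^sub>R ?e)" using d2 D by simp
    from frechet_derivative_along_line[OF this]
    show "((\<lambda>h. partial_deriv i w (x + h *\<^sub>R ?e)) has_real_derivative
        partial_deriv i (partial_deriv i w) x) (at 0)"
      by (simp add: partial_deriv_def[of i "partial_deriv i w"])
  qed
  moreover have "\<forall>\<^sub>F h in nhds 0. ?g 0 \<le> ?g h" using min by simp
  ultimately have "partial_deriv i (partial_deriv i w) x - c \<ge> 0"
    by (rule second_deriv_nonneg_at_local_min)
  then show ?thesis by simp
qed

section \<open>Scalar inequalities for powers and for the radial profile\<close>

text \<open>By the mean value theorem, the derivative of the power on (0, M) gives a Lipschitz
  constant. It serves to control the reaction term in the comparison argument.\<close>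

lemma powr_diff_le:
  fixes s r M p :: real
  assumes "0 \<le> s" "s \<le> r" "r \<le> M" "1 \<le> p"
  shows "r powr p - s powr p \<le> p * M powr (p - 1) * (r - s)"
proof (cases "s = r")
  case False
  then have "s < r" using assms by simp
  have "\<exists>l z. s < z \<and> z < r \<and> ((\<lambda>x. x powr p) has_real_derivative l) (at z) \<and>
      r powr p - s powr p = (r - s) * l"
  proof (rule MVT[OF \<open>s < r\<close>])
    show "continuous_on {s..r} (\<lambda>x. x powr p)"
      using assms by (intro continuous_on_powr') (auto intro: continuous_intros)
    show "(\<lambda>x. x powr p) differentiable (at x)" if "s < x" "x < r" for x
      using has_real_derivative_powr[of x p] that assms
      by (auto simp: real_differentiable_def)
  qed
  then obtain l z where z: "s < z" "z < r" "((\<lambda>x. x powr p) has_real_derivative l) (at z)"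
    and eq: "r powr p - s powr p = (r - s) * l" by blast
  have "l = p * z powr (p - 1)"
    using DERIV_unique[OF z(3) has_real_derivative_powr[of z p]] z assms by simp
  moreover have "z powr (p - 1) \<le> M powr (p - 1)"
    using z assms by (intro powr_mono2) auto
  ultimately have "l \<le> p * M powr (p - 1)" using assms by (simp add: mult_left_mono)
  then show ?thesis using eq \<open>s < r\<close> by (simp add: mult.commute mult_left_mono)
qed simp

text \<open>Near \<open>r = 0\<close>, the edge of the support, the terms \<open>r * (1 - r)\<close> (coming from the shrinking of
  the support) and \<open>d * (1 - r)\<close> dominate; away from it a large \<open>\<mu>\<close> does.\<close>

lemma profile_inequality:
  fixes b C d N p q :: real
  assumes "b \<ge> 0" "C \<ge> 0" "d \<ge> 0" "N \<ge> 0" "p \<ge> 1" "q \<ge> 1"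
  shows "\<exists>\<mu>0\<ge>0. \<forall>\<mu>\<ge>\<mu>0. \<forall>r\<in>{0..1}.
    b * r\<^sup>2 - 2 * r * (1 - r) \<le> d * (8 * (1 - r) - 4 * N * r) + \<mu> * (r\<^sup>2) powr p - C * (r\<^sup>2) powr q"
proof -
  \<comment> \<open>For \<open>r \<le> r0\<close> the first entry lets \<open>r\<close> dominate all
    quadratic terms, with 2 coming from \<open>2 * r * (1 - r)\<close> and \<open>C\<close> from
    absorption. The second keeps \<open>8 * (1 - r) - 4 * N * r\<close> nonnegative. For larger
    \<open>r\<close>, \<open>\<mu>0\<close> makes the reaction term at least
    \<open>b + 4 * N * d + C\<close>, which bounds the unfavourable terms.\<close>
  define r0 where "r0 = min (1 / (b + 2 + C)) (2 / (N + 2))"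
  define \<mu>0 where "\<mu>0 = (b + 4 * N * d + C) / (r0\<^sup>2) powr p"
  have r0: "r0 > 0" using assms by (simp add: r0_def)
  have "b * r\<^sup>2 - 2 * r * (1 - r) \<le> d * (8 * (1 - r) - 4 * N * r) + \<mu> * (r\<^sup>2) powr p - C * (r\<^sup>2) powr q"
    if \<mu>: "\<mu> \<ge> \<mu>0" and r: "0 \<le> r" "r \<le> 1" for \<mu> r
  proof -
    have \<mu>_nonneg: "\<mu> \<ge> 0" using \<mu> assms by (smt (verit) \<mu>0_def divide_nonneg_nonneg mult_nonneg_nonneg powr_ge_zero)
    have r2: "r\<^sup>2 \<le> 1" using r by (simp add: power_le_one)
    have rq: "(r\<^sup>2) powr q \<le> r\<^sup>2"
      using powr_mono'[of 1 q "r\<^sup>2"] r r2 assms by (cases "r = 0") auto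
    have Crq: "C * (r\<^sup>2) powr q \<le> C * r\<^sup>2" using rq assms by (simp add: mult_left_mono)
    show ?thesis
    proof (cases "r \<le> r0")
      case True
      have "(b + 2 + C) * r \<le> 1"
        using True assms by (simp add: r0_def field_simps)
      then have "r * ((b + 2 + C) * r) \<le> r * 1" by (intro mult_left_mono r)
      then have 1: "b * r\<^sup>2 + 2 * r\<^sup>2 + C * r\<^sup>2 \<le> r" by (simp add: algebra_simps power2_eq_square)
      have "(N + 2) * r \<le> 2"
        using True assms by (simp add: r0_def field_simps)
      then have "0 \<le> d * (4 * (2 - (N + 2) * r))"
        using assms by (intro mult_nonneg_nonneg) auto
      then have 2: "0 \<le> d * (8 * (1 - r) - 4 * N * r)" by (simp add: algebra_simps)
      have 3: "0 \<le> \<mu> * (r\<^sup>2) powr p" using \<mu>_nonneg by simp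
      show ?thesis using 1 2 3 Crq r by (simp add: algebra_simps power2_eq_square)
    next
      case False
      have "b + 4 * N * d + C = \<mu>0 * (r0\<^sup>2) powr p" using r0 by (simp add: \<mu>0_def)
      also have "\<dots> \<le> \<mu> * (r\<^sup>2) powr p"
        using False r0 \<mu> \<mu>_nonneg assms by (intro mult_mono powr_mono2 power_mono) auto
      finally have 1: "b + 4 * N * d + C \<le> \<mu> * (r\<^sup>2) powr p" .
      have 2: "b * r\<^sup>2 \<le> b" using r2 assms by (simp add: mult_left_le)
      have 3: "C * r\<^sup>2 \<le> C" using r2 assms by (simp add: mult_left_le)
      have "4 * N * d * r \<le> 4 * N * d" using r assms by (simp add: mult_left_le)
      moreover have "0 \<le> d * (8 * (1 - r))" "0 \<le> 2 * r * (1 - r)" using r assms by simp_all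
      ultimately show ?thesis using 1 2 3 Crq by (simp add: algebra_simps)
    qed
  qed
  moreover have "\<mu>0 \<ge> 0" using assms by (simp add: \<mu>0_def)
  ultimately show ?thesis by auto
qed

section \<open>Derivatives of the self-similar barrier\<close>

text \<open>The positive part is dropped, so the function is smooth for \<open>t < T\<close>. It
  equals the truncated self-similar function only where \<open>|x - x0|^2 \<le> T - t\<close>, and
  comparison is confined to that region.\<close>

definition barrier :: "'a::real_inner \<Rightarrow> real \<Rightarrow> real \<Rightarrow> 'a \<Rightarrow> real \<Rightarrow> real" where
  "barrier x0 b T x t = (T - t) powr (- b) * (1 - (norm (x - x0))\<^sup>2 / (T - t))\<^sup>2"

text \<open>Pulling out \<open>\<tau> powr (- b - 1)\<close> leaves a polynomial in the similarity
  variable \<open>r\<close>. The Laplacian carries the same factor, so the differential inequality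
  becomes one in \<open>r\<close> alone.\<close>

lemma barrier_has_time_derivative:
  fixes x x0 :: "'a::real_inner"
  assumes "t < T"
  defines "\<tau> \<equiv> T - t"
  defines "r \<equiv> 1 - (norm (x - x0))\<^sup>2 / \<tau>"
  shows "(barrier x0 b T x has_real_derivative
           \<tau> powr (- b - 1) * (b * r\<^sup>2 - 2 * r * (1 - r))) (at t)"
proof -
  have \<tau>: "\<tau> > 0" using assms by simp
  have 1: "\<tau> powr (- b) = \<tau> powr (- b - 1) * \<tau>"
    using \<tau> powr_add[of \<tau> "- b - 1" 1] by simp
  have "((\<lambda>t. (T - t) powr (- b) * (1 - (norm (x - x0))\<^sup>2 / (T - t))\<^sup>2) has_real_derivative
     b * \<tau> powr (- b - 1) * r\<^sup>2 + \<tau> powr (- b) * (2 * r * (- ((norm (x - x0))\<^sup>2 / \<tau>\<^sup>2)))) (at t)"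
    using \<tau> unfolding \<tau>_def r_def
    by (auto intro!: derivative_eq_intros simp: power2_eq_square)
  also have "b * \<tau> powr (- b - 1) * r\<^sup>2 + \<tau> powr (- b) * (2 * r * (- ((norm (x - x0))\<^sup>2 / \<tau>\<^sup>2)))
     = \<tau> powr (- b - 1) * (b * r\<^sup>2 - 2 * r * (1 - r))"
    unfolding 1 using \<tau> by (simp add: r_def field_simps power2_eq_square)
  finally show ?thesis by (simp add: barrier_def[abs_def])
qed

lemma barrier_along_axis:
  fixes x x0 :: "real^'n::finite" and i :: 'n
  defines "N \<equiv> (norm (x - x0))\<^sup>2" and "y \<equiv> (x - x0) $ i"
  shows "barrier x0 b T (x + h *\<^sub>R axis i 1) t =
    (T - t) powr (- b) * (1 - (N + 2 * h * y + h\<^sup>2) / (T - t))\<^sup>2"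
proof -
  have "(norm (x + h *\<^sub>R axis i 1 - x0))\<^sup>2 = (norm ((x - x0) + h *\<^sub>R axis i 1))\<^sup>2"
    by (simp add: algebra_simps)
  also have "\<dots> = N + 2 * h * y + h\<^sup>2"
    unfolding N_def y_def power2_norm_eq_inner
    by (simp add: inner_add_left inner_add_right inner_axis inner_axis' power2_eq_square)
      (simp add: algebra_simps)
  finally show ?thesis by (simp add: barrier_def)
qed

text \<open>The left side is the Laplacian of the barrier in terms of \<open>r\<close>. At a local
  minimum of \<open>w\<close> minus the barrier the pure second partials are ordered in each
  coordinate direction, and these inequalities are summed.\<close>

lemma laplacian_ge_barrier_at_touching_point:
  fixes w :: "real^'n::finite \<Rightarrow> real" and x x0 :: "real^'n"
  assumes D: "open D" "x \<in> D" and w: "Ck_on 2 D w" and "t < T"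
    and min: "\<forall>\<^sub>F y in nhds x. w x - barrier x0 b T x t \<le> w y - barrier x0 b T y t"
  defines "\<tau> \<equiv> T - t"
  defines "r \<equiv> 1 - (norm (x - x0))\<^sup>2 / \<tau>"
  shows "\<tau> powr (- b - 1) * (8 * (1 - r) - 4 * real CARD('n) * r) \<le> laplacian w x"
proof -
  have \<tau>: "\<tau> > 0" using assms by simp
  define N where "N = (norm (x - x0))\<^sup>2"
  define k where "k = \<tau> powr (- b)"
  have 1: "k = \<tau> powr (- b - 1) * \<tau>"
    using \<tau> powr_add[of \<tau> "- b - 1" 1] by (simp add: k_def)
  have step: "k * (8 * ((x - x0) $ i)\<^sup>2 / \<tau>\<^sup>2 - 4 * r / \<tau>) \<le> partial_deriv i (partial_deriv i w) x" for i
  proof -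
    define y where "y = (x - x0) $ i"
    define c where "c = inverse \<tau>"
    let ?P = "\<lambda>h. 1 - (N + 2 * h * y + h\<^sup>2) * c"
    let ?G = "\<lambda>h. k * (?P h)\<^sup>2"
    let ?G' = "\<lambda>h. - 4 * k * c * (?P h * (y + h))"
    have rc: "r = 1 - N * c" by (simp add: r_def N_def c_def divide_inverse)
    have bG: "barrier x0 b T (x + h *\<^sub>R axis i 1) t = ?G h" for h
      using barrier_along_axis[of x0 b T x h i t]
      by (simp add: N_def y_def k_def c_def \<tau>_def divide_inverse)
    have "k * (8 * y\<^sup>2 * c\<^sup>2 - 4 * r * c) \<le> partial_deriv i (partial_deriv i w) x"
    proof (rule second_partial_ge_at_touching_point[OF D w])
      show "(?G has_real_derivative ?G' h) (at h)" for h
        by (auto intro!: derivative_eq_intros simp: algebra_simps)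
      show "(?G' has_real_derivative k * (8 * y\<^sup>2 * c\<^sup>2 - 4 * r * c)) (at 0)"
        unfolding rc by (auto intro!: derivative_eq_intros simp: algebra_simps power2_eq_square)
      from eventually_compose_filterlim[OF min tendsto_along_line[of x "axis i 1"]]
      show "\<forall>\<^sub>F h in nhds 0. w x - ?G 0 \<le> w (x + h *\<^sub>R axis i 1) - ?G h"
        using bG[of 0] by (simp add: bG)
    qed
    moreover have "8 * y\<^sup>2 / \<tau>\<^sup>2 - 4 * r / \<tau> = 8 * y\<^sup>2 * c\<^sup>2 - 4 * r * c"
      using \<tau> by (simp add: c_def field_simps power2_eq_square)
    ultimately show ?thesis by (simp add: y_def)
  qed
  have N: "(\<Sum>i\<in>UNIV. ((x - x0) $ i)\<^sup>2) = N"
    unfolding N_def power2_norm_eq_inner inner_vec_def by (simp add: power2_eq_square)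
  \<comment> \<open>The squared coordinates sum to \<open>N = (1 - r) * \<tau>\<close>, which turns
    the sum over directions into an expression in \<open>r\<close>.\<close>
  have "\<tau> powr (- b - 1) * (8 * (1 - r) - 4 * real CARD('n) * r)
      = k * (8 * N / \<tau>\<^sup>2 - real CARD('n) * (4 * r / \<tau>))"
    unfolding 1 using \<tau> by (simp add: r_def N_def field_simps power2_eq_square)
  also have "\<dots> = (\<Sum>i\<in>UNIV. k * (8 * ((x - x0) $ i)\<^sup>2 / \<tau>\<^sup>2 - 4 * r / \<tau>))"
    unfolding sum_distrib_left[symmetric] sum_subtractf sum_divide_distrib[symmetric] N by simp
  also have "\<dots> \<le> laplacian w x"
    unfolding laplacian_def by (intro sum_mono step)
  finally show ?thesis .
qed

section \<open>Subsolution property and comparison on the shrinking ball\<close>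

text \<open>The choice of \<open>b\<close> gives \<open>b * p = b + 1\<close>, so time derivative,
  diffusion and reaction share the factor \<open>\<tau> powr (- b - 1)\<close>. The absorption term
  has the extra factor \<open>\<tau> powr (- b * (q - p))\<close>, which \<open>absorption\<close>
  bounds together with \<open>a\<close>. What remains is \<open>profile\<close>.\<close>

lemma barrier_subsolution_inequality:
  fixes x x0 :: "real^'n::finite"
  assumes p: "p > 1" and b: "b = 1 / (p - 1)" and t: "t < T"
    and inside: "(norm (x - x0))\<^sup>2 \<le> T - t"
    and absorption: "a * (T - t) powr (- b * (q - p)) \<le> C"
    and profile: "\<forall>r\<in>{0..1}. b * r\<^sup>2 - 2 * r * (1 - r) \<le>
       d * (8 * (1 - r) - 4 * N * r) + \<mu> * (r\<^sup>2) powr p - C * (r\<^sup>2) powr q"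
  defines "\<tau> \<equiv> T - t"
  defines "r \<equiv> 1 - (norm (x - x0))\<^sup>2 / \<tau>"
  shows "\<tau> powr (- b - 1) * (b * r\<^sup>2 - 2 * r * (1 - r)) \<le>
    d * (\<tau> powr (- b - 1) * (8 * (1 - r) - 4 * N * r))
      + \<mu> * barrier x0 b T x t powr p - a * barrier x0 b T x t powr q"
proof -
  have \<tau>: "\<tau> > 0" using t by (simp add: \<tau>_def)
  have r: "r \<in> {0..1}" using inside \<tau> by (simp add: r_def \<tau>_def)
  define K where "K = \<tau> powr (- b - 1)"
  have bp: "- b * p = - b - 1" using p by (simp add: b field_simps)
  have B: "barrier x0 b T x t = \<tau> powr (- b) * r\<^sup>2" by (simp add: barrier_def \<tau>_def r_def)
  have Bp: "barrier x0 b T x t powr p = K * (r\<^sup>2) powr p"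
    unfolding B K_def using bp by (simp add: powr_mult powr_powr)
  have "- b * q = (- b - 1) + - b * (q - p)" using bp by (simp add: algebra_simps)
  then have "\<tau> powr (- b * q) = K * \<tau> powr (- b * (q - p))"
    unfolding K_def by (simp only: powr_add)
  then have Bq: "barrier x0 b T x t powr q = K * (\<tau> powr (- b * (q - p)) * (r\<^sup>2) powr q)"
    unfolding B by (simp add: powr_mult powr_powr)
  have "a * \<tau> powr (- b * (q - p)) * (r\<^sup>2) powr q \<le> C * (r\<^sup>2) powr q"
    using absorption by (intro mult_right_mono) (auto simp: \<tau>_def)
  with profile[rule_format, OF r]
  have "b * r\<^sup>2 - 2 * r * (1 - r) \<le> d * (8 * (1 - r) - 4 * N * r) + \<mu> * (r\<^sup>2) powr p
      - a * \<tau> powr (- b * (q - p)) * (r\<^sup>2) powr q" by linarith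
  then have "K * (b * r\<^sup>2 - 2 * r * (1 - r)) \<le> K * (d * (8 * (1 - r) - 4 * N * r) + \<mu> * (r\<^sup>2) powr p
      - a * \<tau> powr (- b * (q - p)) * (r\<^sup>2) powr q)"
    by (rule mult_left_mono) (simp add: K_def)
  then show ?thesis unfolding Bp Bq K_def[symmetric] by (simp add: algebra_simps)
qed

text \<open>A negative minimum of the difference, weighted exponentially in time, contradicts the
  two differential inequalities. The weight compensates for the growth of the reaction term in
  \<open>u\<close>. The lateral boundary only uses \<open>u \<ge> 0\<close>.\<close>

lemma barrier_le_supersolution:
  fixes u :: "real^'n::finite \<Rightarrow> real \<Rightarrow> real"
  assumes D: "open D" "cball x0 (sqrt T) \<subseteq> D"
    and cont: "continuous_on (D \<times> {0..}) (\<lambda>(x, t). u x t)"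
    and C2: "\<And>t. t > 0 \<Longrightarrow> Ck_on 2 D (\<lambda>x. u x t)"
    and diff: "\<And>x t. x \<in> D \<Longrightarrow> t > 0 \<Longrightarrow> u x differentiable (at t)"
    and eq: "\<And>x t. x \<in> D \<Longrightarrow> t > 0 \<Longrightarrow>
      deriv (u x) t \<ge> d * laplacian (\<lambda>y. u y t) x + \<mu> * u x t powr p - a x * u x t powr q"
    and nonneg: "\<And>x t. x \<in> D \<Longrightarrow> t \<ge> 0 \<Longrightarrow> u x t \<ge> 0"
    and init: "\<And>x. x \<in> cball x0 (sqrt T) \<Longrightarrow> barrier x0 b T x 0 \<le> u x 0"
    and p: "p > 1" and b: "b = 1 / (p - 1)" and "q \<ge> 0" "d \<ge> 0" "\<mu> \<ge> 0"
    and a: "\<And>x. a x \<ge> 0"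
    and absorption: "\<And>x t. 0 < t \<Longrightarrow> t < T \<Longrightarrow> (norm (x - x0))\<^sup>2 \<le> T - t \<Longrightarrow>
      a x * (T - t) powr (- b * (q - p)) \<le> C"
    and profile: "\<forall>r\<in>{0..1}. b * r\<^sup>2 - 2 * r * (1 - r) \<le>
       d * (8 * (1 - r) - 4 * real CARD('n) * r) + \<mu> * (r\<^sup>2) powr p - C * (r\<^sup>2) powr q"
    and x: "(norm (x - x0))\<^sup>2 \<le> T - t" and t: "0 \<le> t" "t < T"
  shows "barrier x0 b T x t \<le> u x t"
proof (rule ccontr)
  assume contra: "\<not> barrier x0 b T x t \<le> u x t"
  define B where "B = barrier x0 b T"
  \<comment> \<open>\<open>M\<close> bounds the barrier up to time \<open>t\<close>, because
    \<open>(T - s) powr (- b)\<close> increases with \<open>s\<close>. \<open>L\<close> exceeds the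
    Lipschitz constant of the reaction on [0, M] by 1, which makes the final contradiction
    strict.\<close>
  define M where "M = (T - t) powr (- b)"
  define L where "L = \<mu> * (p * M powr (p - 1)) + 1"
  \<comment> \<open>Stopping at \<open>t < T\<close> keeps the compact set away from the singular
    vertex \<open>(x0, T)\<close>.\<close>
  define Q where "Q = {(y, s). 0 \<le> s \<and> s \<le> t \<and> (norm (y - x0))\<^sup>2 \<le> T - s}"
  define Z where "Z = (\<lambda>(y, s). exp (- L * s) * (u y s - B y s))"
  have b_pos: "b > 0" using p b by simp
  have QD: "y \<in> cball x0 (sqrt T)" if "(y, s) \<in> Q" for y s
    using that unfolding Q_def
    by (auto simp: dist_norm norm_minus_commute intro!: real_le_rsqrt)
  have "compact Q"
  proof (rule compact_eq_bounded_closed[THEN iffD2, OF conjI])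
    have "Q \<subseteq> cball x0 (sqrt T) \<times> {0..t}" using QD by (auto simp: Q_def)
    then show "bounded Q" by (rule bounded_subset[rotated]) (simp add: bounded_Times)
    have "Q = {z. 0 \<le> snd z} \<inter> {z. snd z \<le> t} \<inter> {z. (norm (fst z - x0))\<^sup>2 \<le> T - snd z}"
      by (auto simp: Q_def)
    then show "closed Q" by (auto intro!: closed_Int closed_Collect_le continuous_intros)
  qed
  moreover have "(x, t) \<in> Q" using x t by (simp add: Q_def)
  then have "Q \<noteq> {}" by blast
  moreover have "continuous_on Q Z"
  proof -
    have "continuous_on Q (\<lambda>(y, s). u y s)"
      by (rule continuous_on_subset[OF cont]) (use QD D in \<open>force simp: Q_def\<close>)
    moreover have "continuous_on Q (\<lambda>(y, s). B y s)"
      unfolding B_def barrier_def case_prod_unfold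
      using t by (auto intro!: continuous_intros simp: Q_def)
    ultimately show ?thesis
      unfolding Z_def case_prod_unfold by (intro continuous_intros)
  qed
  ultimately obtain z where z: "z \<in> Q" and zmin: "\<And>z'. z' \<in> Q \<Longrightarrow> Z z \<le> Z z'"
    using continuous_attains_inf by metis
  obtain y s where ys: "z = (y, s)" by (cases z)
  have Zneg: "Z z < 0"
    using zmin[OF \<open>(x, t) \<in> Q\<close>] contra by (auto simp: Z_def B_def mult_pos_neg intro: le_less_trans)
  then have less: "u y s < B y s" by (simp add: ys Z_def mult_less_0_iff)
  have s: "0 \<le> s" "s \<le> t" "(norm (y - x0))\<^sup>2 \<le> T - s" using z by (auto simp: ys Q_def)
  have sT: "s < T" using s t by simp
  have yD: "y \<in> D" using QD z D by (auto simp: ys)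
  \<comment> \<open>The minimum lies neither at the initial time nor on the lateral boundary, where
    the barrier vanishes. The top \<open>s = t\<close> remains possible.\<close>
  have "s \<noteq> 0" using init QD z less by (force simp: ys B_def)
  then have s_pos: "s > 0" using s by simp
  have "(norm (y - x0))\<^sup>2 \<noteq> T - s"
    using less nonneg[OF yD s(1)] sT by (auto simp: B_def barrier_def)
  then have inside: "(norm (y - x0))\<^sup>2 < T - s" using s by simp
  define \<tau> where "\<tau> = T - s"
  define r where "r = 1 - (norm (y - x0))\<^sup>2 / \<tau>"
  define Bt where "Bt = \<tau> powr (- b - 1) * (b * r\<^sup>2 - 2 * r * (1 - r))"
  have Bt: "(B y has_real_derivative Bt) (at s)"
    unfolding B_def Bt_def r_def \<tau>_def by (rule barrier_has_time_derivative[OF sT])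
  have ut: "(u y has_real_derivative deriv (u y) s) (at s)"
    using diff[OF yD s_pos] DERIV_deriv_iff_real_differentiable by blast

  \<comment> \<open>Since \<open>s = t\<close> may occur, only earlier times are compared: otherwise
    the weighted difference would be strictly smaller just before \<open>s\<close>. The point stays
    in \<open>Q\<close> because its sections widen backwards in time.\<close>
  have time: "deriv (u y) s - Bt \<le> L * (u y s - B y s)"
  proof (rule ccontr)
    assume *: "\<not> ?thesis"
    have "((\<lambda>s. exp (- L * s) * (u y s - B y s)) has_real_derivative
        exp (- L * s) * (deriv (u y) s - Bt - L * (u y s - B y s))) (at s)"
      by (rule derivative_eq_intros ut Bt refl | simp add: algebra_simps)+
    moreover have "exp (- L * s) * (deriv (u y) s - Bt - L * (u y s - B y s)) > 0"
      using * by simp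
    ultimately obtain e where e: "e > 0" and eD: "\<And>h. h > 0 \<Longrightarrow> h < e \<Longrightarrow>
        exp (- L * (s - h)) * (u y (s - h) - B y (s - h)) < exp (- L * s) * (u y s - B y s)"
      using DERIV_pos_inc_left by blast
    define h where "h = min e s / 2"
    have h: "h > 0" "h < e" "h < s" using e s_pos by (auto simp: h_def)
    have "(y, s - h) \<in> Q" using s h by (simp add: Q_def)
    from zmin[OF this] eD[OF h(1,2)] show False by (simp add: ys Z_def)
  qed

  \<comment> \<open>At fixed time the weight is constant, so the minimum of \<open>Z\<close> is a
    spatial minimum of \<open>u - B\<close>. Strictness of \<open>inside\<close> supplies a full
    neighbourhood.\<close>
  have space: "\<tau> powr (- b - 1) * (8 * (1 - r) - 4 * real CARD('n) * r) \<le> laplacian (\<lambda>y. u y s) y"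
    unfolding \<tau>_def r_def
  proof (rule laplacian_ge_barrier_at_touching_point[OF D(1) yD C2[OF s_pos] sT])
    have "open {y'. (norm (y' - x0))\<^sup>2 < T - s}"
      by (intro open_Collect_less continuous_intros)
    then have "\<forall>\<^sub>F y' in nhds y. (norm (y' - x0))\<^sup>2 < T - s"
      using inside by (auto simp: eventually_nhds)
    then show "\<forall>\<^sub>F y' in nhds y. u y s - barrier x0 b T y s \<le> u y' s - barrier x0 b T y' s"
    proof eventually_elim
      case (elim y')
      then have "(y', s) \<in> Q" using s by (simp add: Q_def)
      from zmin[OF this] show ?case by (simp add: ys Z_def B_def)
    qed
  qed

  have sub: "Bt \<le> d * (\<tau> powr (- b - 1) * (8 * (1 - r) - 4 * real CARD('n) * r))
      + \<mu> * B y s powr p - a y * B y s powr q"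
    unfolding Bt_def B_def r_def \<tau>_def
    by (rule barrier_subsolution_inequality[OF p b sT s(3) absorption[OF s_pos sT s(3)] profile])
  have "B y s \<le> M"
  proof -
    have "0 \<le> r" "r \<le> 1" using s sT by (auto simp: r_def \<tau>_def)
    then have "r\<^sup>2 \<le> 1" by (simp add: power_le_one)
    moreover have "\<tau> powr (- b) \<le> M"
      unfolding M_def \<tau>_def using s t b_pos by (intro powr_mono2') auto
    ultimately have "\<tau> powr (- b) * r\<^sup>2 \<le> M * 1" by (intro mult_mono) (auto simp: M_def)
    then show ?thesis by (simp add: B_def barrier_def r_def \<tau>_def)
  qed
  then have "B y s powr p - u y s powr p \<le> p * M powr (p - 1) * (B y s - u y s)"
    using nonneg[OF yD s(1)] less p by (intro powr_diff_le) auto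
  then have reaction: "\<mu> * (B y s powr p - u y s powr p) \<le> \<mu> * (p * M powr (p - 1) * (B y s - u y s))"
    using \<open>\<mu> \<ge> 0\<close> by (rule mult_left_mono)
  \<comment> \<open>Absorption has the favourable sign: where \<open>u < B\<close> it acts less on
    \<open>u\<close>, so monotonicity suffices.\<close>
  have "u y s powr q \<le> B y s powr q"
    using nonneg[OF yD s(1)] less \<open>q \<ge> 0\<close> by (intro powr_mono2) auto
  then have "a y * u y s powr q \<le> a y * B y s powr q"
    using a by (rule mult_left_mono)
  moreover have "d * (\<tau> powr (- b - 1) * (8 * (1 - r) - 4 * real CARD('n) * r))
      \<le> d * laplacian (\<lambda>y. u y s) y"
    using space \<open>d \<ge> 0\<close> by (rule mult_left_mono)
  ultimately have "deriv (u y) s - Bt \<ge> \<mu> * u y s powr p - \<mu> * B y s powr p"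
    using eq[OF yD s_pos] sub by linarith
  \<comment> \<open>Combined with \<open>time\<close> this gives
    \<open>(L - 1) * (u - B) \<le> L * (u - B)\<close>, impossible for
    \<open>u - B < 0\<close>.\<close>
  with reaction have "deriv (u y) s - Bt \<ge> (L - 1) * (u y s - B y s)"
    by (simp add: L_def algebra_simps)
  with time less show False by (simp add: algebra_simps)
qed

section \<open>Degeneracy of the absorption coefficient\<close>

text \<open>Differentiability gives a linear bound on \<open>v x0 - v x\<close>, hence one by a
  multiple of \<open>sqrt \<tau>\<close>. The product is then at most a constant times
  \<open>\<tau> powr (\<sigma> / 2 - b * (q - p))\<close>, with nonnegative exponent and base at
  most 1.\<close>

lemma absorption_bound_near_zero:
  fixes v :: "'a::real_normed_vector \<Rightarrow> real"
  assumes v: "v differentiable (at x0)" and p: "p > 1" "q \<ge> p"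
    and \<sigma>: "\<sigma> \<ge> 2 * (q - p) / (p - 1)" and b: "b = 1 / (p - 1)"
  shows "\<exists>C\<ge>0. \<exists>\<delta>>0. \<forall>x \<tau>. norm (x - x0) < \<delta> \<longrightarrow> (norm (x - x0))\<^sup>2 \<le> \<tau> \<longrightarrow> 0 < \<tau> \<longrightarrow> \<tau> \<le> 1 \<longrightarrow>
    npow \<bar>v x0 - v x\<bar> \<sigma> * \<tau> powr (- b * (q - p)) \<le> C"
proof (cases "\<sigma> = 0")
  \<comment> \<open>Here \<open>q = p\<close>, and \<open>npow\<close> is 1 even where
    \<open>v x = v x0\<close>, so the product equals 1.\<close>
  case True
  then have "q = p" using \<sigma> p by (simp add: divide_le_0_iff)
  then show ?thesis using True by (intro exI[of _ 1] conjI) (auto simp: npow_def intro: exI[of _ "1::real"])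
next
  case False
  have "0 \<le> 2 * (q - p) / (p - 1)" using p by simp
  then have \<sigma>_pos: "\<sigma> > 0" using \<sigma> False by linarith
  obtain v' where v': "(v has_derivative v') (at x0)" using v by (auto simp: differentiable_def)
  obtain K where K: "K > 0" "\<And>h. norm (v' h) \<le> norm h * K"
    using bounded_linear.pos_bounded[OF has_derivative_bounded_linear[OF v']] by blast
  \<comment> \<open>The remainder is taken with tolerance 1, whence the constant
    \<open>K + 1\<close>.\<close>
  obtain \<delta> where \<delta>: "\<delta> > 0"
    and \<delta>D: "\<And>x. norm (x - x0) < \<delta> \<Longrightarrow> norm (v x - v x0 - v' (x - x0)) \<le> 1 * norm (x - x0)"
    using v'[unfolded has_derivative_at_alt] by (metis zero_less_one)
  have "npow \<bar>v x0 - v x\<bar> \<sigma> * \<tau> powr (- b * (q - p)) \<le> (K + 1) powr \<sigma>"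
    if x: "norm (x - x0) < \<delta>" "(norm (x - x0))\<^sup>2 \<le> \<tau>" and \<tau>: "0 < \<tau>" "\<tau> \<le> 1" for x \<tau>
  proof -
    have "\<bar>v x0 - v x\<bar> \<le> (K + 1) * norm (x - x0)"
      using \<delta>D[OF x(1)] K(2)[of "x - x0"] by (simp add: algebra_simps)
    also have "\<dots> \<le> (K + 1) * \<tau> powr (1/2)"
      using K x by (intro mult_left_mono) (auto simp: powr_half_sqrt \<tau> less_imp_le real_le_rsqrt)
    finally have "\<bar>v x0 - v x\<bar> powr \<sigma> \<le> ((K + 1) * \<tau> powr (1/2)) powr \<sigma>"
      using \<sigma>_pos by (intro powr_mono2) auto
    also have "\<dots> = (K + 1) powr \<sigma> * \<tau> powr (\<sigma> / 2)"
      using K by (simp add: powr_mult powr_powr)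
    finally have "npow \<bar>v x0 - v x\<bar> \<sigma> * \<tau> powr (- b * (q - p))
        \<le> (K + 1) powr \<sigma> * \<tau> powr (\<sigma> / 2) * \<tau> powr (- b * (q - p))"
      using False by (simp add: npow_def mult_right_mono)
    also have "\<dots> = (K + 1) powr \<sigma> * \<tau> powr (\<sigma> / 2 - b * (q - p))"
      by (simp add: powr_add[symmetric])
    also have "\<dots> \<le> (K + 1) powr \<sigma> * 1"
      using \<sigma> p \<tau> by (intro mult_left_mono powr_le1) (auto simp: b field_simps)
    finally show ?thesis by simp
  qed
  then show ?thesis using \<delta> by (intro exI[of _ "(K + 1) powr \<sigma>"]) auto
qed

section \<open>Finite-time blowup above the threshold\<close>

lemma admissible_domain_open: "admissible_domain P D \<Longrightarrow> open D"
  by (cases P) (auto simp: smooth_bounded_domain_def)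

theorem proposition4p1:
  fixes P :: problem_kind
    and D :: "(real^'n::finite) set"
    and d1 d2 m \<sigma> p q :: real
    and f :: "real^'n \<Rightarrow> real \<Rightarrow> real"
    and v0 :: "real^'n \<Rightarrow> real"
    and x0 :: "real^'n"
  assumes "admissible_domain P D"
    and "d1 \<ge> 0" and "d2 \<ge> 0"
    and "smooth_on (D \<times> UNIV) (\<lambda>(x, s). f x s)"
    and "stationary_solution P D d1 f v0"
    and "\<forall>x\<in>D. v0 x \<ge> 0"
    and "x0 \<in> D" and "m = v0 x0"
    and "p > 1" and "q \<ge> p"
    and "\<sigma> \<ge> 2 * (q - p) / (p - 1)"
    and "CARD('n) \<ge> 3 \<Longrightarrow> 1 < q \<and> q < (real CARD('n) + 2) / (real CARD('n) - 2)"
  shows "\<exists>\<mu>0\<ge>0. \<exists>\<phi>. initial_threshold D \<phi> \<and>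
           (\<forall>\<mu>\<ge>\<mu>0. \<forall>u0 u T.
              (\<forall>x\<in>D. u0 x \<ge> 0) \<and> (\<forall>x\<in>D. u0 x \<ge> \<phi> x) \<and>
              maximal_solution P D d1 d2 f \<mu> m \<sigma> p q v0 u0 (\<lambda>x t. v0 x) u T
              \<longrightarrow> T < \<infinity>)"
proof -
  define b where "b = 1 / (p - 1)"
  have b_pos: "b > 0" using assms(9) by (simp add: b_def)
  have D: "open D" using assms(1) by (rule admissible_domain_open)
  have "v0 differentiable (at x0)"
    using assms(5,7) by (auto simp: stationary_solution_def numeral_2_eq_2)
  from absorption_bound_near_zero[OF this assms(9-11) b_def]
  obtain C \<delta> where C: "C \<ge> 0" and \<delta>: "\<delta> > 0"
    and a_bound: "\<And>x \<tau>. norm (x - x0) < \<delta> \<Longrightarrow> (norm (x - x0))\<^sup>2 \<le> \<tau> \<Longrightarrow> 0 < \<tau> \<Longrightarrow> \<tau> \<le> 1 \<Longrightarrow>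
      npow \<bar>v0 x0 - v0 x\<bar> \<sigma> * \<tau> powr (- b * (q - p)) \<le> C" by blast
  obtain \<mu>0 where \<mu>0: "\<mu>0 \<ge> 0" and profile: "\<And>\<mu>. \<mu> \<ge> \<mu>0 \<Longrightarrow> \<forall>r\<in>{0..1}.
      b * r\<^sup>2 - 2 * r * (1 - r) \<le> d2 * (8 * (1 - r) - 4 * real CARD('n) * r)
        + \<mu> * (r\<^sup>2) powr p - C * (r\<^sup>2) powr q"
    using profile_inequality[of b C d2 "real CARD('n)" p q] b_pos C assms(3,9,10) by auto
  obtain \<epsilon> where \<epsilon>: "\<epsilon> > 0" "cball x0 \<epsilon> \<subseteq> D"
    using D assms(7) open_contains_cball by blast
  \<comment> \<open>\<open>S\<close> is the blowup time of the barrier and \<open>R\<close> the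
    radius of its initial support. The entries of the minimum ensure \<open>\<tau> \<le> 1\<close>,
    a ball inside \<open>D\<close>, and a radius strictly below \<open>\<delta>\<close>.\<close>
  define R where "R = min 1 (min \<epsilon> (\<delta> / 2))"
  define S where "S = R\<^sup>2"
  have R: "0 < R" "R \<le> 1" "R \<le> \<epsilon>" "R < \<delta>" using \<epsilon> \<delta> by (auto simp: R_def)
  have S: "0 < S" "S \<le> 1" "sqrt S = R" using R by (auto simp: S_def power_le_one)
  have ballD: "cball x0 (sqrt S) \<subseteq> D" using \<epsilon> R S by (auto simp: subset_iff)
  \<comment> \<open>This is the barrier at time 0 with the positive part restored, which makes it
    continuous with compact support. It does not depend on \<open>\<mu>\<close>.\<close>
  define \<phi> where "\<phi> x = S powr (- b) * (max 0 (1 - (norm (x - x0))\<^sup>2 / S))\<^sup>2" for x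
  have \<phi>: "initial_threshold D \<phi>"
    unfolding initial_threshold_def
  proof (intro conjI exI[of _ "cball x0 (sqrt S)"])
    show "continuous_on UNIV \<phi>"
      unfolding \<phi>_def[abs_def] using S by (intro continuous_intros) auto
    have "1 - (norm (x - x0))\<^sup>2 / S \<le> 0" if "x \<notin> cball x0 (sqrt S)" for x
    proof -
      have "R \<le> norm (x - x0)" using that S by (simp add: dist_norm norm_minus_commute)
      then have "S \<le> (norm (x - x0))\<^sup>2" using R unfolding S_def by (intro power_mono) auto
      then show ?thesis using S by simp
    qed
    then show "\<forall>x. x \<notin> cball x0 (sqrt S) \<longrightarrow> \<phi> x = 0" by (simp add: \<phi>_def max_absorb1)
  qed (use ballD in \<open>auto simp: \<phi>_def\<close>)
  have "T < \<infinity>"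
    if \<mu>: "\<mu> \<ge> \<mu>0" and u0: "\<forall>x\<in>D. u0 x \<ge> \<phi> x"
      and sol: "maximal_solution P D d1 d2 f \<mu> m \<sigma> p q v0 u0 (\<lambda>x t. v0 x) u T"
    for \<mu> u0 u T
  proof (rule ccontr)
    \<comment> \<open>For a global solution the barrier's blowup time \<open>S\<close> is an
      interior time, at which \<open>u x0\<close> must be finite and continuous.\<close>
    assume "\<not> T < \<infinity>"
    then have T: "T = \<infinity>" by simp
    have times: "times T = {0..}" and open_times: "open_times T = {0<..}"
      by (auto simp: T times_def open_times_def)
    have par: "parabolic_solution P D d2
       (\<lambda>x t s. \<mu> * npow s p - npow \<bar>m - v0 x\<bar> \<sigma> * npow s q) u0 u T"
      and nonneg: "\<And>x t. x \<in> D \<Longrightarrow> t \<ge> 0 \<Longrightarrow> u x t \<ge> 0"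
      using sol by (auto simp: maximal_solution_def system_solution_def times)
    have diff: "u x differentiable (at t)" if "x \<in> D" "t > 0" for x t
      using par that by (auto simp: parabolic_solution_def C21_on_def open_times)
    have blowup: "(S - t) powr (- b) \<le> u x0 t" if t: "0 \<le> t" "t < S" for t
    proof -
      have "barrier x0 b S x0 t \<le> u x0 t"
      proof (rule barrier_le_supersolution[where a = "\<lambda>x. npow \<bar>m - v0 x\<bar> \<sigma>", OF D ballD
              _ _ _ _ _ _ _ b_def _ _ _ _ _ profile[OF \<mu>]])
        show "continuous_on (D \<times> {0..}) (\<lambda>(x, t). u x t)"
          using par unfolding parabolic_solution_def times
          by (blast intro: continuous_on_subset)
        show "Ck_on 2 D (\<lambda>x. u x t)" if "t > 0" for t
          using par that by (auto simp: parabolic_solution_def C21_on_def open_times)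
        \<comment> \<open>As \<open>p\<close> and \<open>q\<close> are nonzero, \<open>npow\<close>
          of \<open>u\<close> is \<open>powr\<close>; only the coefficient keeps the convention for
          \<sigma> = 0.\<close>
        show "d2 * laplacian (\<lambda>y. u y t) x + \<mu> * u x t powr p
            - npow \<bar>m - v0 x\<bar> \<sigma> * u x t powr q \<le> deriv (u x) t" if "x \<in> D" "t > 0" for x t
          using par that assms(9,10)
          by (auto simp: parabolic_solution_def open_times npow_def)
        show "barrier x0 b S x 0 \<le> u x 0" if x: "x \<in> cball x0 (sqrt S)" for x
        proof -
          have "norm (x - x0) \<le> R" using x S by (simp add: dist_norm norm_minus_commute)
          then have "(norm (x - x0))\<^sup>2 \<le> S" unfolding S_def by (intro power_mono) auto
          then have "barrier x0 b S x 0 = \<phi> x" using S by (simp add: barrier_def \<phi>_def max_def)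
          also have "\<dots> \<le> u x 0"
            using u0 par x ballD by (auto simp: parabolic_solution_def subset_iff)
          finally show ?thesis .
        qed
        show "npow \<bar>m - v0 x\<bar> \<sigma> * (S - t) powr (- b * (q - p)) \<le> C"
          if "0 < t" "t < S" "(norm (x - x0))\<^sup>2 \<le> S - t" for x t
        proof -
          have "(norm (x - x0))\<^sup>2 \<le> R\<^sup>2" using that by (simp add: S_def)
          then have "norm (x - x0) \<le> R" by (rule power2_le_imp_le) (rule less_imp_le[OF R(1)])
          then show ?thesis
            unfolding assms(8) using that R S by (intro a_bound) auto
        qed
        show "(norm (x0 - x0))\<^sup>2 \<le> S - t" using t by simp
        show "0 \<le> npow \<bar>m - v0 x\<bar> \<sigma>" for x by (simp add: npow_def)
      qed (use assms(3,9,10) \<mu> \<mu>0 t in \<open>simp_all add: diff nonneg\<close>)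
      then show ?thesis by (simp add: barrier_def)
    qed
    have "isCont (u x0) S"
      using diff[OF assms(7) S(1)] by (rule differentiable_imp_continuous_within)
    then have lim: "(u x0 \<longlongrightarrow> u x0 S) (at_left S)"
      unfolding isCont_def by (rule tendsto_mono[OF at_le, rotated]) simp
    \<comment> \<open>After multiplication by \<open>(S - t) powr b\<close> the lower bound becomes
      1, while continuity of \<open>u x0\<close> and \<open>b > 0\<close> force the limit 0.\<close>
    have "((\<lambda>t. (S - t) powr b * u x0 t) \<longlongrightarrow> (S - S) powr b * u x0 S) (at_left S)"
      using b_pos lim by (intro tendsto_mult tendsto_powr' tendsto_diff tendsto_const tendsto_ident_at)
        (auto simp: eventually_at_filter)
    moreover have "\<forall>\<^sub>F t in at_left S. 1 \<le> (S - t) powr b * u x0 t"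
      using eventually_at_left_real[OF S(1)]
    proof eventually_elim
      case (elim t)
      then have "(S - t) powr b * (S - t) powr (- b) \<le> (S - t) powr b * u x0 t"
        using blowup[of t] by (intro mult_left_mono) auto
      then show ?case using elim by (simp add: powr_add[symmetric])
    qed
    ultimately have "1 \<le> (S - S) powr b * u x0 S"
      by (rule tendsto_lowerbound) simp
    then show False by simp
  qed
  then show ?thesis using \<mu>0 \<phi> by blast
qed

end
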